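(* Let $0<a<\frac12$ and let $C\subset S^1$ be an arc with $P(C)=a$, where $P$ is the normalized arc-length measure on the unit circle $S^1$. For a sequence $\{u_j\}_{j\ge 1}$ of points of $S^1$ consider the condition $$( * )\qquad \lim_{N\to\infty}\frac1N\sum_{j=1}^N\chi_{\rho C}(u_j)=a\quad\text{for every rotation }\rho\text{ of } S^1 .$$ Then: (i) if $a$ is rational, a sequence satisfying $( * )$ need not be uniformly distributed on $S^1$; that is, for every rational $a\in(0,\frac12)$ and every such arc $C$ there exists a sequence $\{u_j\}$ in $S^1$ satisfying $( * )$ which is not uniformly distributed on $S^1$; (ii) if $a$ is irrational, every sequence $\{u_j\}$ in $S^1$ satisfying $( * )$ is uniformly distributed on $S^1$.
   Context: $S^1$ is the unit circle in $\mathbb{R}^2$, and $P$ is arc length on $S^1$ divided by $2\pi$. An arc here is a cap of $S^1$, i.e. the portion of the circle cut off by a line, taken closed: $C=\{v\in S^1: u\cdot v\ge s\}$ for some $u\in S^1$ and some real $s$. $\chi_A$ denotes the indicator function of $A$. A sequence $\{u_j\}$ of points of $S^1$ is uniformly distributed on $S^1$ if $\lim_{N\to\infty}\frac1N\sum_{j=1}^N\chi_A(u_j)=P(A)$ for every $P$-continuity set $A\subset S^1$, i.e. every Borel set $A$ with $P(\partial A)=0$, where $\partial A$ is the boundary of $A$ relative to $S^1$. *)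

theory Defs
  imports "HOL-Analysis.Analysis"
begin

definition S1 :: "(real^2) set" where
  "S1 = sphere 0 1"

definition circle_point :: "real \<Rightarrow> real^2" where
  "circle_point t = vector [cos t, sin t]"

text \<open>
  Arc length on the Borel sets of the circle. The parametrization below has unit speed and runs
  through the circle exactly once, so the arc length of a Borel set is the Lebesgue measure of its
  set of parameters.
\<close>

definition arc_length :: "(real^2) measure" where
  "arc_length = distr (restrict_space lborel {0..<2 * pi}) (restrict_space borel S1) circle_point"

definition circle_prob :: "(real^2) measure" where
  "circle_prob = scale_measure (ennreal (1 / (2 * pi))) arc_length"

definition is_arc :: "(real^2) set \<Rightarrow> bool" where
  "is_arc C \<longleftrightarrow> (\<exists>u\<in>S1. \<exists>s. C = {v \<in> S1. u \<bullet> v \<ge> s})"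

definition is_continuity_set :: "(real^2) set \<Rightarrow> bool" where
  "is_continuity_set A \<longleftrightarrow>
     A \<in> sets circle_prob \<and> measure circle_prob (top_of_set S1 frontier_of A) = 0"

text \<open>Sequences are indexed by the positive integers; the value at \<open>0\<close> is irrelevant.\<close>

definition has_frequency :: "(nat \<Rightarrow> real^2) \<Rightarrow> (real^2) set \<Rightarrow> real \<Rightarrow> bool" where
  "has_frequency u A p \<longleftrightarrow>
     (\<lambda>N. (1 / real N) * (\<Sum>j=1..N. indicat_real A (u j))) \<longlonglongrightarrow> p"

definition uniformly_distributed :: "(nat \<Rightarrow> real^2) \<Rightarrow> bool" where
  "uniformly_distributed u \<longleftrightarrow>
     (\<forall>A. is_continuity_set A \<longrightarrow> has_frequency u A (measure circle_prob A))"

lemma circle_point_in_S1: "circle_point t \<in> S1"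
  by (simp add: S1_def circle_point_def norm_vec_def L2_set_def sum_2)

lemma bij_betw_circle_point: "bij_betw circle_point {0..<2 * pi} S1"
proof (rule bij_betw_imageI)
  show "inj_on circle_point {0..<2 * pi}"
  proof (rule inj_onI)
    fix s t assume st: "s \<in> {0..<2 * pi}" "t \<in> {0..<2 * pi}" "circle_point s = circle_point t"
    then have "cos s = cos t" "sin s = sin t"
      by (metis circle_point_def vector_2)+
    then have "cis s = cis t"
      by (simp add: complex_eq_iff)
    with st show "s = t"
      by (metis Arg2pi_unique atLeastLessThan_iff cis_conv_exp mult_1 of_real_1 zero_less_one)
  qed
  have "v \<in> circle_point ` {0..<2 * pi}" if "v \<in> S1" for v
  proof -
    have "(v $ 1)\<^sup>2 + (v $ 2)\<^sup>2 = 1"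
      using that by (simp add: S1_def norm_vec_def L2_set_def sum_2)
    then obtain t where "0 \<le> t" "t < 2 * pi" "v $ 1 = cos t" "v $ 2 = sin t"
      using sincos_total_2pi by metis
    then have "v = circle_point t"
      by (simp add: circle_point_def vec_eq_iff forall_2)
    with \<open>0 \<le> t\<close> \<open>t < 2 * pi\<close> show ?thesis
      by auto
  qed
  then show "circle_point ` {0..<2 * pi} = S1"
    using circle_point_in_S1 by auto
qed

lemma circle_point_measurable:
  "circle_point \<in> restrict_space lborel {0..<2 * pi} \<rightarrow>\<^sub>M restrict_space borel S1"
proof -
  have "circle_point = (\<lambda>t. \<chi> i. if i = 1 then cos t else sin t)"
    by (simp add: fun_eq_iff circle_point_def vec_eq_iff forall_2)
  moreover have "continuous_on UNIV (\<lambda>t. (\<chi> i. if i = 1 then cos t else sin t) :: real^2)"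
  proof (intro continuous_on_vec_lambda)
    show "continuous_on UNIV (\<lambda>t::real. if i = 1 then cos t else sin t)" for i :: 2
      by (cases "i = 1") (auto intro!: continuous_intros)
  qed
  ultimately have "circle_point \<in> borel_measurable borel"
    by (metis borel_measurable_continuous_onI)
  then show ?thesis
    by (intro measurable_restrict_space1 measurable_restrict_space2)
       (auto simp: circle_point_in_S1)
qed

lemma sets_circle_prob: "sets circle_prob = {A. A \<subseteq> S1 \<and> A \<in> sets borel}"
proof -
  have "S1 \<inter> space borel \<in> sets (borel :: (real^2) measure)"
    by (simp add: S1_def borel_closed)
  then show ?thesis
    by (auto simp: circle_prob_def arc_length_def sets_restrict_space_iff)
qed

lemma space_circle_prob: "space circle_prob = S1"
  by (simp add: circle_prob_def arc_length_def space_scale_measure space_restrict_space)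

lemma emeasure_circle_prob_S1: "emeasure circle_prob S1 = 1"
proof -
  have "emeasure arc_length S1 = ennreal (2 * pi)"
    using emeasure_distr[OF circle_point_measurable, of S1] circle_point_in_S1
    by (simp add: arc_length_def space_restrict_space sets_restrict_space_iff S1_def borel_closed
        emeasure_restrict_space vimage_def)
  then show ?thesis
    by (simp add: circle_prob_def flip: ennreal_mult)
qed

end

theory Submission
  imports Defs
begin

text \<open>
  A rotation moves the point at angle \<open>t\<close> to the point at angle \<open>t + \<theta>\<close>, and every arc of
  measure \<open>a\<close> is a cap of angular radius \<open>pi * a\<close> (lemma \<open>arc_eq_cap\<close>). So the hypothesis on the
  sequence says that every such cap, whatever its centre \<open>\<phi>\<close>, is hit with frequency \<open>a\<close>.

  Let \<open>a\<close> be irrational and let the sequence have angles \<open>x j\<close>. As a function of the centre \<open>\<phi>\<close>,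
  the frequency with which the first \<open>N\<close> points hit the cap is the convolution of the empirical
  distribution with the indicator of an interval. It is bounded by 1 and tends to the constant
  \<open>a\<close> at every \<open>\<phi>\<close>, so by dominated convergence each of its Fourier coefficients of index
  \<open>n \<noteq> 0\<close> tends to 0. Such a coefficient is a product: the average of \<open>cis (n * x j)\<close> over
  \<open>j \<le> N\<close> times the \<open>n\<close>-th Fourier coefficient of the interval. The latter is a nonzero multiple of
  \<open>sin (n * pi * a)\<close>, which does not vanish because \<open>a\<close> is irrational. So the exponential averages
  tend to 0 (lemma \<open>weyl_sums_tendsto_0\<close>). Weyl's criterion finishes the proof: averages converge
  for trigonometric polynomials, then by Stone-Weierstrass for continuous functions (lemma
  \<open>continuous_average\<close>), then for continuity sets, because the indicator of a closed set is a
  decreasing limit of continuous functions (lemma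
  \<open>uniformly_distributed_if_continuous_averages\<close>).

  Let \<open>a = p / q\<close> be rational. An arc of that length contains exactly \<open>p\<close> of the \<open>q\<close> vertices of an
  inscribed regular \<open>q\<close>-gon, except that it contains \<open>p + 1\<close> of them when its endpoints
  are vertices. A sequence that runs through the vertices of pairwise disjoint regular \<open>q\<close>-gons one
  after the other meets the exceptional case for at most one polygon, so it hits every
  arc of length \<open>a\<close> with frequency \<open>p / q\<close> (lemma \<open>drifting_polygon_frequency\<close>). If the polygons
  converge to a fixed one, then all points of the sequence lie in a countable closed set. That is
  a continuity set of measure 0 which is hit with frequency 1, so the sequence is not uniformly
  distributed (lemma \<open>drifting_polygon_not_uniformly_distributed\<close>).
\<close>

section \<open>Integrals of periodic functions\<close>

text \<open>
  After removing full turns, the window \<open>{c..<c + 2 * pi}\<close> becomes \<open>{r..<r + 2 * pi}\<close> with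
  \<open>0 \<le> r < 2 * pi\<close>; the part of it beyond \<open>2 * pi\<close>, moved back by one period, fills the gap \<open>{0..<r}\<close>.
  This is the rotation invariance of arc length.
\<close>

lemma period_integral_shift:
  fixes h :: "real \<Rightarrow> 'a::{banach, second_countable_topology}"
  assumes per: "\<And>t. h (t + 2 * pi) = h t"
    and int: "set_integrable lborel {0..<2 * pi} h"
  shows "(LINT t:{0..<2 * pi}|lborel. h (t + c)) = (LINT t:{0..<2 * pi}|lborel. h t)"
proof -
  \<comment> \<open>\<open>c\<close> is \<open>k\<close> full turns plus \<open>r\<close>.\<close>
  define k where "k = \<lfloor>c / (2 * pi)\<rfloor>"
  define r where "r = c - 2 * pi * k"
  have r: "0 \<le> r" "r < 2 * pi"
    using floor_divide_lower[of "2 * pi" c] floor_divide_upper[of "2 * pi" c]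
    by (auto simp: r_def k_def algebra_simps)
  have pern: "h (t + 2 * pi * real n) = h t" for t n
  proof (induction n)
    case (Suc n)
    have "h (t + 2 * pi * real (Suc n)) = h ((t + 2 * pi * real n) + 2 * pi)"
      by (simp add: algebra_simps)
    with Suc show ?case by (simp only: per)
  qed simp
  have peri: "h (t + 2 * pi * of_int m) = h t" for t m
  proof (cases "m \<ge> 0")
    case True
    then show ?thesis using pern[of t "nat m"] by simp
  next
    case False
    then show ?thesis using pern[of "t + 2 * pi * of_int m" "nat (- m)"] by simp
  qed
  have sub: "set_integrable lborel A h" if "A \<subseteq> {0..<2 * pi}" "A \<in> sets lborel" for A
    using set_integrable_subset[OF int that(2,1)] .
  have "(LINT t:{0..<2 * pi}|lborel. h (t + c)) = (\<integral>t. indicator {r..<r + 2 * pi} (r + t) *\<^sub>R h (r + t) \<partial>lborel)"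
    unfolding set_lebesgue_integral_def
  proof (rule Bochner_Integration.integral_cong[OF refl])
    fix t
    show "indicator {0..<2 * pi} t *\<^sub>R h (t + c) = indicator {r..<r + 2 * pi} (r + t) *\<^sub>R h (r + t)"
      using peri[of "r + t" k] by (auto simp: indicator_def r_def algebra_simps)
  qed
  also have "\<dots> = (LINT t:{r..<r + 2 * pi}|lborel. h t)"
    unfolding set_lebesgue_integral_def
    using lborel_integral_real_affine[of 1 "\<lambda>t. indicator {r..<r + 2 * pi} t *\<^sub>R h t" r] by simp
  also have "{r..<r + 2 * pi} = {r..<2 * pi} \<union> {2 * pi..<r + 2 * pi}"
    using r by auto
  also have "(LINT t:{r..<2 * pi} \<union> {2 * pi..<r + 2 * pi}|lborel. h t)
      = (LINT t:{r..<2 * pi}|lborel. h t) + (LINT t:{2 * pi..<r + 2 * pi}|lborel. h t)"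
  proof (rule set_integral_Un)
    show "set_integrable lborel {r..<2 * pi} h"
      using r by (intro sub) auto
    have "set_integrable lborel {0..<r} h"
      using r by (intro sub) auto
    then have "integrable lborel (\<lambda>t. indicator {0..<r} (- (2 * pi) + 1 * t) *\<^sub>R h (- (2 * pi) + 1 * t))"
      unfolding set_integrable_def by (rule lborel_integrable_real_affine) simp
    moreover have "indicator {0..<r} (- (2 * pi) + 1 * t) *\<^sub>R h (- (2 * pi) + 1 * t)
        = indicator {2 * pi..<r + 2 * pi} t *\<^sub>R h t" for t
      using per[of "t - 2 * pi"] by (auto simp: indicator_def)
    ultimately show "set_integrable lborel {2 * pi..<r + 2 * pi} h"
      by (simp add: set_integrable_def)
  qed auto
  also have "(LINT t:{2 * pi..<r + 2 * pi}|lborel. h t) = (LINT t:{0..<r}|lborel. h t)"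
  proof -
    have "(LINT t:{2 * pi..<r + 2 * pi}|lborel. h t)
        = (\<integral>t. indicator {2 * pi..<r + 2 * pi} (2 * pi + t) *\<^sub>R h (2 * pi + t) \<partial>lborel)"
      unfolding set_lebesgue_integral_def
      using lborel_integral_real_affine[of 1 "\<lambda>t. indicator {2 * pi..<r + 2 * pi} t *\<^sub>R h t" "2 * pi"] by simp
    also have "\<dots> = (LINT t:{0..<r}|lborel. h t)"
      unfolding set_lebesgue_integral_def
      using per by (intro Bochner_Integration.integral_cong[OF refl]) (auto simp: indicator_def add.commute)
    finally show ?thesis .
  qed
  also have "(LINT t:{r..<2 * pi}|lborel. h t) + (LINT t:{0..<r}|lborel. h t)
      = (LINT t:{r..<2 * pi} \<union> {0..<r}|lborel. h t)"
    using r by (intro set_integral_Un[symmetric] sub) auto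
  also have "{r..<2 * pi} \<union> {0..<r} = {0..<2 * pi}"
    using r by auto
  finally show ?thesis .
qed

lemma bounded_set_integrable:
  fixes h :: "real \<Rightarrow> 'a::{banach, second_countable_topology}"
  assumes "h \<in> borel_measurable borel" and "\<And>t. norm (h t) \<le> B"
  shows "set_integrable lborel {a..<b} h"
proof (rule set_integrable_bound)
  show "set_integrable lborel {a..<b} (\<lambda>t. B)"
    by (cases "a \<le> b") (auto simp: set_integrable_def)
  show "set_borel_measurable lborel {a..<b} h"
    using assms(1) by (simp add: set_borel_measurable_def)
  show "AE x in lborel. x \<in> {a..<b} \<longrightarrow> norm (h x) \<le> norm B"
    using assms(2) by (intro AE_I2) (smt (verit) real_norm_def)
qed

lemma integral_Ico_eq_Icc:
  fixes h :: "real \<Rightarrow> 'a::{banach, second_countable_topology}"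
  shows "(LINT t:{a..<b}|lborel. h t) = (LINT t:{a..b}|lborel. h t)"
  by (rule set_integral_discrete_difference[where X="{b}"]) auto

lemma integral_character:
  assumes "a \<le> b" "n \<noteq> 0"
  shows "(LINT t:{a..b}|lborel. cis (of_int n * t))
    = (cis (of_int n * b) - cis (of_int n * a)) / (\<i> * of_int n)"
proof -
  have "(LINT t:{a..b}|lborel. cis (of_int n * t))
    = (cis (of_int n * b) / (\<i> * of_int n)) - (cis (of_int n * a) / (\<i> * of_int n))"
    unfolding set_lebesgue_integral_def
  proof (rule integral_FTC_atLeastAtMost)
    show "((\<lambda>t. cis (of_int n * t) / (\<i> * of_int n)) has_vector_derivative cis (of_int n * x)) (at x within {a..b})"
      for x
    proof -
      have "((\<lambda>t. exp (\<i> * of_int n * of_real t) / (\<i> * of_int n)) has_vector_derivative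
          exp (\<i> * of_int n * of_real x)) (at x within {a..b})"
        using \<open>n \<noteq> 0\<close> by (auto intro!: derivative_eq_intros has_vector_derivative_real_field)
      then show ?thesis by (simp add: cis_conv_exp mult.assoc)
    qed
    show "continuous_on {a..b} (\<lambda>t. cis (of_int n * t))"
      by (intro continuous_intros)
  qed (use assms in auto)
  then show ?thesis by (simp add: diff_divide_distrib)
qed

lemma integral_character_period:
  assumes "n \<noteq> 0"
  shows "(LINT t:{0..<2 * pi}|lborel. cis (of_int n * t)) = 0"
proof -
  have "cis (of_int n * (2 * pi)) = 1"
    using cis_multiple_2pi[of "of_int n"] by (simp add: mult.commute mult.left_commute)
  then show ?thesis
    using assms by (simp add: integral_Ico_eq_Icc integral_character)
qed

lemma cis_int_period: "cis (of_int n * (t + 2 * pi)) = cis (of_int n * t)"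
  using cis_multiple_2pi[of "of_int n"]
  by (simp add: distrib_left cis_mult[symmetric] mult.commute mult.left_commute)

section \<open>Integration on the circle\<close>

lemma integral_circle_prob:
  fixes f :: "real^2 \<Rightarrow> 'a::{banach, second_countable_topology}"
  assumes f: "f \<in> borel_measurable circle_prob"
  shows "integral\<^sup>L circle_prob f = (1 / (2 * pi)) *\<^sub>R (LINT t:{0..<2 * pi}|lborel. f (circle_point t))"
proof -
  have f': "f \<in> borel_measurable (restrict_space borel S1)"
    using f by (simp add: circle_prob_def arc_length_def cong: measurable_cong_sets)
  have f'': "f \<in> borel_measurable arc_length"
    using f by (simp add: circle_prob_def cong: measurable_cong_sets)
  have "circle_prob = density arc_length (\<lambda>_. ennreal (1 / (2 * pi)))"
    by (rule measure_eqI) (auto simp: circle_prob_def emeasure_density_const)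
  then have "integral\<^sup>L circle_prob f = (1 / (2 * pi)) *\<^sub>R integral\<^sup>L arc_length f"
    using integral_density[OF f'', of "\<lambda>_. 1 / (2 * pi)"] by simp
  also have "integral\<^sup>L arc_length f = (LINT t:{0..<2 * pi}|lborel. f (circle_point t))"
    unfolding arc_length_def set_lebesgue_integral_def
    by (simp add: integral_distr[OF circle_point_measurable f'] integral_restrict_space)
  finally show ?thesis .
qed

lemma finite_measure_circle_prob: "finite_measure circle_prob"
  by (rule finite_measureI) (simp add: space_circle_prob emeasure_circle_prob_S1)

lemma measure_circle_prob_eq_integral:
  assumes "A \<in> sets circle_prob"
  shows "measure circle_prob A
    = (1 / (2 * pi)) * (LINT t:{0..<2 * pi}|lborel. indicator A (circle_point t))"
proof -
  interpret finite_measure circle_prob by (rule finite_measure_circle_prob)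
  have "measure circle_prob A = integral\<^sup>L circle_prob (indicator A)"
    using assms by simp
  also have "\<dots> = (1 / (2 * pi)) *\<^sub>R (LINT t:{0..<2 * pi}|lborel. indicator A (circle_point t))"
    using assms by (intro integral_circle_prob) simp
  finally show ?thesis by simp
qed

lemma circle_point_surj: 
  assumes "v \<in> S1" obtains t where "v = circle_point t"
  using assms bij_betw_imp_surj_on[OF bij_betw_circle_point] by blast

lemma circle_point_inner: "circle_point s \<bullet> circle_point t = cos (t - s)"
  by (simp add: circle_point_def inner_vec_def sum_2 cos_diff)

section \<open>Rotations and caps\<close>

text \<open>
  For a rotation matrix, orthonormality of the columns and determinant 1 together say that
  \<open>(R 11 - R 22)^2 + (R 21 + R 12)^2 = 0\<close>, so the first column determines the second.
\<close>

lemma rotation_circle_point: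
  assumes "rotation_matrix (R :: real^2^2)"
  obtains \<theta> where "\<And>t. R *v circle_point t = circle_point (t + \<theta>)"
proof -
  have o: "orthogonal_matrix R" and d: "det R = 1"
    using assms by (auto simp: rotation_matrix_def)
  have "transpose R ** R = mat 1" using o by (simp add: orthogonal_matrix)
  then have "(transpose R ** R) $ i $ j = mat 1 $ i $ j" for i j by simp
  from this[of 1 1] this[of 1 2] this[of 2 2]
  have e: "(R$1$1)\<^sup>2 + (R$2$1)\<^sup>2 = 1" "R$1$1 * R$1$2 + R$2$1 * R$2$2 = 0" "(R$1$2)\<^sup>2 + (R$2$2)\<^sup>2 = 1"
    by (simp_all add: matrix_matrix_mult_def transpose_def mat_def sum_2 power2_eq_square)
  have d': "R$1$1 * R$2$2 - R$1$2 * R$2$1 = 1" using d by (simp add: det_2)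
  have "(R$1$1 - R$2$2)\<^sup>2 + (R$2$1 + R$1$2)\<^sup>2 = 0"
    using e d' by (simp add: power2_eq_square algebra_simps)
  then have r: "R$2$2 = R$1$1" "R$1$2 = - R$2$1"
    by (auto simp: sum_power2_eq_zero_iff)
  obtain \<theta> where \<theta>: "R$1$1 = cos \<theta>" "R$2$1 = sin \<theta>"
    using sincos_total_2pi e(1) by metis
  have "R *v circle_point t = circle_point (t + \<theta>)" for t
    using r \<theta> by (simp add: vec_eq_iff forall_2 circle_point_def matrix_vector_mult_def sum_2 cos_add sin_add)
  then show thesis by (rule that)
qed

lemma rotation_exists:
  obtains R :: "real^2^2" where "rotation_matrix R" "\<And>t. R *v circle_point t = circle_point (t + \<theta>)"
proof -
  define R :: "real^2^2" where "R = vector [vector [cos \<theta>, - sin \<theta>], vector [sin \<theta>, cos \<theta>]]"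
  have "rotation_matrix R"
    by (simp add: rotation_matrix_def orthogonal_matrix R_def vec_eq_iff forall_2
        matrix_matrix_mult_def transpose_def mat_def sum_2 det_2
        flip: power2_eq_square)
  moreover have "R *v circle_point t = circle_point (t + \<theta>)" for t
    by (simp add: R_def vec_eq_iff forall_2 circle_point_def matrix_vector_mult_def sum_2 cos_add sin_add)
  ultimately show thesis by (rule that)
qed

text \<open>
  Arcs indexed by the angle \<open>\<phi>\<close> of their centre, so that a rotation by \<open>\<theta>\<close> only
  replaces \<open>\<phi>\<close> by \<open>\<phi> + \<theta>\<close>.
\<close>

definition cap :: "real \<Rightarrow> real \<Rightarrow> (real^2) set" where
  "cap \<phi> s = {v \<in> S1. s \<le> circle_point \<phi> \<bullet> v}"

lemma circle_point_in_cap_iff: "circle_point t \<in> cap \<phi> s \<longleftrightarrow> s \<le> cos (t - \<phi>)"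
  by (simp add: cap_def circle_point_in_S1 circle_point_inner)

lemma cap_in_sets: "cap \<phi> s \<in> sets circle_prob"
proof -
  have "closed {v. s \<le> circle_point \<phi> \<bullet> v}"
    by (intro closed_Collect_le continuous_intros)
  then have "closed (S1 \<inter> {v. s \<le> circle_point \<phi> \<bullet> v})"
    by (intro closed_Int) (auto simp: S1_def)
  moreover have "S1 \<inter> {v. s \<le> circle_point \<phi> \<bullet> v} = cap \<phi> s" by (auto simp: cap_def)
  ultimately have "cap \<phi> s \<in> sets borel" by (metis borel_closed)
  then show ?thesis by (auto simp: sets_circle_prob cap_def)
qed

lemma image_cap:
  assumes "\<And>t. R *v circle_point t = circle_point (t + \<theta>)"
  shows "(\<lambda>v. R *v v) ` cap \<phi> s = cap (\<phi> + \<theta>) s"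
proof (intro subset_antisym subsetI)
  fix v assume "v \<in> (\<lambda>v. R *v v) ` cap \<phi> s"
  then obtain w where w: "w \<in> cap \<phi> s" "v = R *v w" by blast
  then obtain t where "w = circle_point t" using circle_point_surj by (auto simp: cap_def)
  with w show "v \<in> cap (\<phi> + \<theta>) s"
    by (simp add: assms circle_point_in_cap_iff)
next
  fix v assume v: "v \<in> cap (\<phi> + \<theta>) s"
  then obtain t where t: "v = circle_point t" using circle_point_surj by (auto simp: cap_def)
  have "v = R *v circle_point (t - \<theta>)" by (simp add: assms t)
  moreover have "circle_point (t - \<theta>) \<in> cap \<phi> s"
    using v by (simp add: t circle_point_in_cap_iff algebra_simps)
  ultimately show "v \<in> (\<lambda>v. R *v v) ` cap \<phi> s" by blast
qed

lemma all_rotations_cap: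
  "(\<forall>R :: real^2^2. rotation_matrix R \<longrightarrow> P ((\<lambda>v. R *v v) ` cap \<phi> s)) \<longleftrightarrow> (\<forall>\<psi>. P (cap \<psi> s))"
proof
  assume L: "\<forall>R :: real^2^2. rotation_matrix R \<longrightarrow> P ((\<lambda>v. R *v v) ` cap \<phi> s)"
  show "\<forall>\<psi>. P (cap \<psi> s)"
  proof
    fix \<psi>
    obtain R :: "real^2^2" where "rotation_matrix R" "\<And>t. R *v circle_point t = circle_point (t + (\<psi> - \<phi>))"
      using rotation_exists[of "\<psi> - \<phi>"] by blast
    then show "P (cap \<psi> s)" using L image_cap[of R "\<psi> - \<phi>" \<phi> s] by auto
  qed
next
  assume "\<forall>\<psi>. P (cap \<psi> s)"
  then show "\<forall>R :: real^2^2. rotation_matrix R \<longrightarrow> P ((\<lambda>v. R *v v) ` cap \<phi> s)"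
    by (metis rotation_circle_point image_cap)
qed

section \<open>Fourier coefficients of caps\<close>

lemma cos_pi_le_cos_iff:
  assumes "0 \<le> b" "b \<le> 1" "\<bar>t\<bar> \<le> pi"
  shows "cos (pi * b) \<le> cos t \<longleftrightarrow> \<bar>t\<bar> \<le> pi * b"
proof -
  have "cos t = cos \<bar>t\<bar>" by simp
  then show ?thesis
    using cos_mono_le_eq[of "pi * b" "\<bar>t\<bar>"] assms by (simp add: mult_left_le)
qed

lemma indicator_measurable_cos: "(\<lambda>t :: real. indicator {s..} (cos t) :: real) \<in> borel_measurable borel"
proof -
  have "closed {t :: real. s \<le> cos t}"
    by (intro closed_Collect_le continuous_intros)
  then have "indicator {t :: real. s \<le> cos t} \<in> borel_measurable (borel :: real measure)"
    by (intro borel_measurable_indicator borel_closed)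
  moreover have "(\<lambda>t :: real. indicator {s..} (cos t) :: real) = indicator {t. s \<le> cos t}"
    by (auto simp: indicator_def)
  ultimately show ?thesis by simp
qed

text \<open>
  As a function of the centre \<open>t\<close>, the indicator of "the point \<open>x\<close> lies in the cap centred at \<open>t\<close>" is
  an even function of \<open>t - x\<close>. Substituting \<open>t - x\<close> splits off the character at \<open>x\<close>, and over the
  period \<open>{-pi..pi}\<close> the remaining condition on the cosine describes an interval around 0.
  The case \<open>n = 0\<close> computes the measure of a cap.
\<close>

lemma cap_fourier:
  assumes "0 \<le> b" "b \<le> 1"
  shows "(LINT t:{0..<2 * pi}|lborel. indicator {cos (pi * b)..} (cos (x - t)) *\<^sub>R cis (of_int n * t))
     = cis (of_int n * x) * (LINT t:{- (pi * b)..pi * b}|lborel. cis (of_int n * t))"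
proof -
  define g where "g t = (indicator {cos (pi * b)..} (cos t) :: real) *\<^sub>R cis (of_int n * t)" for t
  have cm: "(\<lambda>t. cis (of_int n * t)) \<in> borel_measurable borel"
    by (intro borel_measurable_continuous_onI continuous_intros)
  have gm: "g \<in> borel_measurable borel"
    unfolding g_def by (intro borel_measurable_scaleR cm indicator_measurable_cos)
  have gi: "set_integrable lborel {0..<2 * pi} g"
    by (rule bounded_set_integrable[OF gm, of 1]) (auto simp: g_def indicator_def)
  have gp: "g (t + 2 * pi) = g t" for t
    unfolding g_def by (simp only: cis_int_period cos_periodic)
  have "(LINT t:{0..<2 * pi}|lborel. indicator {cos (pi * b)..} (cos (x - t)) *\<^sub>R cis (of_int n * t))
     = (LINT t:{0..<2 * pi}|lborel. cis (of_int n * x) * g (t + - x))"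
    using cos_minus[of "x - t" for t]
    by (simp add: g_def cis_mult algebra_simps)
  also have "\<dots> = cis (of_int n * x) * (LINT t:{0..<2 * pi}|lborel. g (t + - x))"
    by simp
  also have "(LINT t:{0..<2 * pi}|lborel. g (t + - x)) = (LINT t:{0..<2 * pi}|lborel. g t)"
    by (rule period_integral_shift[OF gp gi])
  \<comment> \<open>The symmetric period is where the cosine condition becomes a single interval.\<close>
  also have "\<dots> = (LINT t:{0..<2 * pi}|lborel. g (t + - pi))"
    by (rule period_integral_shift[OF gp gi, symmetric])
  also have "\<dots> = (\<integral>t. indicator {-pi..<pi} (- pi + t) *\<^sub>R g (- pi + t) \<partial>lborel)"
    unfolding set_lebesgue_integral_def
    by (intro Bochner_Integration.integral_cong[OF refl]) (auto simp: indicator_def add.commute)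
  also have "\<dots> = (LINT t:{-pi..<pi}|lborel. g t)"
    unfolding set_lebesgue_integral_def
    using lborel_integral_real_affine[of 1 "\<lambda>t. indicator {-pi..<pi} t *\<^sub>R g t" "-pi"] by simp
  also have "\<dots> = (LINT t:{-pi..pi}|lborel. g t)"
    by (rule integral_Ico_eq_Icc)
  also have "\<dots> = (LINT t:{- (pi * b)..pi * b}|lborel. cis (of_int n * t))"
    unfolding set_lebesgue_integral_def
  proof (rule Bochner_Integration.integral_cong[OF refl])
    fix t
    have "- pi \<le> t" "t \<le> pi" if "- (pi * b) \<le> t" "t \<le> pi * b"
      using that mult_left_le[of b pi] assms pi_ge_zero by linarith+
    then show "indicator {-pi..pi} t *\<^sub>R g t = indicator {- (pi * b)..pi * b} t *\<^sub>R cis (of_int n * t)"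
      using cos_pi_le_cos_iff[OF assms, of t] by (auto simp: g_def indicator_def abs_le_iff)
  qed
  finally show ?thesis .
qed

lemma measure_cap:
  assumes "0 \<le> b" "b \<le> 1"
  shows "measure circle_prob (cap \<phi> (cos (pi * b))) = b"
proof -
  have "complex_of_real (LINT t:{0..<2 * pi}|lborel. indicator (cap \<phi> (cos (pi * b))) (circle_point t))
     = (LINT t:{0..<2 * pi}|lborel. complex_of_real (indicator (cap \<phi> (cos (pi * b))) (circle_point t)))"
    by (rule set_integral_complex_of_real[symmetric])
  also have "\<dots> = (LINT t:{0..<2 * pi}|lborel. indicator {cos (pi * b)..} (cos (\<phi> - t)) *\<^sub>R cis (of_int 0 * t))"
  proof -
    have "complex_of_real (indicator (cap \<phi> (cos (pi * b))) (circle_point t))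
        = indicator {cos (pi * b)..} (cos (\<phi> - t)) *\<^sub>R cis (of_int 0 * t)" for t
      using cos_minus[of "\<phi> - t"] by (simp add: indicator_def circle_point_in_cap_iff)
    then show ?thesis by presburger
  qed
  also have "\<dots> = complex_of_real (2 * pi * b)"
  proof -
    have "(LINT t:{- (pi * b)..pi * b}|lborel. cis (of_int 0 * t)) = complex_of_real (2 * pi * b)"
      using assms by (simp add: set_lebesgue_integral_def scaleR_conv_of_real)
    then show ?thesis by (simp only: cap_fourier[OF assms]) simp
  qed
  finally have "(LINT t:{0..<2 * pi}|lborel. indicator (cap \<phi> (cos (pi * b))) (circle_point t)) = 2 * pi * b"
    by (simp only: of_real_eq_iff)
  then show ?thesis
    by (simp add: measure_circle_prob_eq_integral cap_in_sets)
qed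

text \<open>
  An arc is a cap of some height \<open>s\<close>. The bounds on its measure exclude the empty arc (\<open>s > 1\<close>) and
  the full circle (\<open>s < - 1\<close>), so \<open>s\<close> is the cosine of an angle, which the measure determines.
\<close>

lemma arc_eq_cap:
  assumes "is_arc C" "measure circle_prob C = a" "0 < a" "a < 1"
  obtains \<phi> where "C = cap \<phi> (cos (pi * a))"
proof -
  obtain u s where u: "u \<in> S1" "C = {v \<in> S1. u \<bullet> v \<ge> s}"
    using assms(1) by (auto simp: is_arc_def)
  obtain \<phi> where "u = circle_point \<phi>" using u(1) circle_point_surj by blast
  then have C: "C = cap \<phi> s" by (simp add: u cap_def)
  have "s \<le> 1"
  proof (rule ccontr)
    assume "\<not> s \<le> 1"
    then have "cap \<phi> s = {}"
      using cos_le_one order_trans unfolding cap_def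
      by (metis (mono_tags, lifting) circle_point_inner circle_point_surj empty_Collect_eq)
    then show False using assms C by simp
  qed
  have "- 1 \<le> s"
  proof (rule ccontr)
    assume "\<not> - 1 \<le> s"
    then have "cap \<phi> s = S1"
    proof -
      have "v \<in> cap \<phi> s" if "v \<in> S1" for v
      proof -
        obtain t where t: "v = circle_point t" using \<open>v \<in> S1\<close> by (rule circle_point_surj)
        have "s \<le> cos (t - \<phi>)" using \<open>\<not> - 1 \<le> s\<close> cos_ge_minus_one[of "t - \<phi>"] by linarith
        then show ?thesis by (simp add: t circle_point_in_cap_iff)
      qed
      then show ?thesis by (auto simp: cap_def)
    qed
    then show False using assms C by (simp add: measure_def emeasure_circle_prob_S1)
  qed
  define b where "b = arccos s / pi"
  have b: "0 \<le> b" "b \<le> 1" "cos (pi * b) = s"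
    using \<open>s \<le> 1\<close> \<open>- 1 \<le> s\<close> by (simp_all add: b_def arccos_lbound arccos_ubound)
  have "b = a" using measure_cap[OF b(1,2), of \<phi>] assms(2) C b(3) by simp
  with C b that show thesis by blast
qed

text \<open>
  This is where irrationality enters: up to a nonzero factor the integral is \<open>sin (n * pi * a)\<close>,
  which vanishes only if \<open>n * a\<close> is an integer.
\<close>

lemma irrational_cap_fourier_nonzero:
  assumes "0 < a" "a \<notin> \<rat>" "n \<noteq> 0"
  shows "(LINT t:{- (pi * a)..pi * a}|lborel. cis (of_int n * t)) \<noteq> 0"
proof
  assume "(LINT t:{- (pi * a)..pi * a}|lborel. cis (of_int n * t)) = 0"
  moreover have "- (pi * a) \<le> pi * a" using assms by simp
  ultimately have "cis (of_int n * (pi * a)) = cis (of_int n * - (pi * a))"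
    using assms(3) by (simp add: integral_character)
  then have "sin (of_int n * (pi * a)) = 0"
    by (simp add: complex_eq_iff)
  then obtain k :: int where "of_int n * (pi * a) = of_int k * pi"
    by (auto simp: sin_zero_iff_int2)
  then have "a = of_int k / of_int n"
    using assms(3) by (simp add: field_simps)
  then show False using assms(2) by simp
qed

text \<open>
  The frequency of the cap, as a function of its centre \<open>\<phi>\<close>, converges to a constant at every \<open>\<phi>\<close>.
  Taking \<open>n\<close>-th Fourier coefficients turns this into convergence to 0 of the exponential averages
  multiplied by the nonzero coefficient of the cap.
\<close>

lemma weyl_sums_tendsto_0:
  assumes a: "0 < a" "a < 1" "a \<notin> \<rat>" and n: "n \<noteq> 0"
    and freq: "\<And>\<phi>. has_frequency (\<lambda>j. circle_point (x j)) (cap \<phi> (cos (pi * a))) a"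
  shows "(\<lambda>N. (1 / real N) *\<^sub>R (\<Sum>j=1..N. cis (of_int n * x j))) \<longlonglongrightarrow> 0"
proof -
  define s where "s = cos (pi * a)"
  define c where "c = (LINT t:{- (pi * a)..pi * a}|lborel. cis (of_int n * t))"
  define F where "F N t = (1 / real N) * (\<Sum>j=1..N. indicator {s..} (cos (x j - t)))" for N t
  have c: "c \<noteq> 0"
    unfolding c_def by (rule irrational_cap_fourier_nonzero[OF a(1,3) n])
  have cm: "(\<lambda>t. cis (of_int n * t)) \<in> borel_measurable borel"
    by (intro borel_measurable_continuous_onI continuous_intros)
  have im: "(\<lambda>t. indicator {s..} (cos (x j - t)) :: real) \<in> borel_measurable borel" for j
    using measurable_compose[OF _ indicator_measurable_cos, of "\<lambda>t. x j - t" borel s] by simp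
  have Fm: "F N \<in> borel_measurable borel" for N
    unfolding F_def by (intro borel_measurable_times borel_measurable_sum im borel_measurable_const)
  have F1: "\<bar>F N t\<bar> \<le> 1" for N t
  proof -
    have "(\<Sum>j=1..N. indicator {s..} (cos (x j - t))) \<le> (\<Sum>j=1..N. 1 :: real)"
      by (intro sum_mono) (simp add: indicator_def)
    moreover have "0 \<le> (\<Sum>j=1..N. indicator {s..} (cos (x j - t)) :: real)"
      by (intro sum_nonneg) simp
    ultimately show ?thesis
      unfolding F_def by (cases "N = 0") (auto simp: divide_le_eq)
  qed
  have lim: "(\<lambda>N. F N t) \<longlonglongrightarrow> a" for t
  proof -
    have "indicator {s..} (cos (x j - t)) = (indicator (cap t s) (circle_point (x j)) :: real)" for j
      by (simp add: indicator_def circle_point_in_cap_iff)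
    then show ?thesis using freq[of t] by (simp add: has_frequency_def F_def s_def)
  qed
  have "(\<lambda>N. LINT t:{0..<2 * pi}|lborel. F N t *\<^sub>R cis (of_int n * t))
     \<longlonglongrightarrow> (LINT t:{0..<2 * pi}|lborel. a *\<^sub>R cis (of_int n * t))"
    unfolding set_lebesgue_integral_def
  proof (rule integral_dominated_convergence)
    show "integrable lborel (indicat_real {0..<2 * pi})" by simp
    show "AE t in lborel. (\<lambda>N. indicat_real {0..<2 * pi} t *\<^sub>R F N t *\<^sub>R cis (of_int n * t))
        \<longlonglongrightarrow> indicat_real {0..<2 * pi} t *\<^sub>R a *\<^sub>R cis (of_int n * t)"
      by (intro AE_I2 tendsto_intros lim)
    show "AE t in lborel. norm (indicat_real {0..<2 * pi} t *\<^sub>R F N t *\<^sub>R cis (of_int n * t))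
        \<le> indicat_real {0..<2 * pi} t" for N
      using F1 by (intro AE_I2) (simp add: indicator_def)
  qed (use cm Fm in \<open>simp_all add: borel_measurable_scaleR\<close>)
  also have "(LINT t:{0..<2 * pi}|lborel. a *\<^sub>R cis (of_int n * t)) = 0"
    using integral_character_period[OF n] by simp
  also have "(\<lambda>N. LINT t:{0..<2 * pi}|lborel. F N t *\<^sub>R cis (of_int n * t))
     = (\<lambda>N. ((1 / real N) *\<^sub>R (\<Sum>j=1..N. cis (of_int n * x j))) * c)"
  proof
    fix N
    have int: "set_integrable lborel {0..<2 * pi} (\<lambda>t. indicat_real {s..} (cos (x j - t)) *\<^sub>R cis (of_int n * t))" for j
      by (rule bounded_set_integrable[where B=1]) (auto intro!: borel_measurable_scaleR im cm simp: indicator_def)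
    have "(LINT t:{0..<2 * pi}|lborel. F N t *\<^sub>R cis (of_int n * t))
      = (LINT t:{0..<2 * pi}|lborel. (1 / real N) *\<^sub>R (\<Sum>j=1..N. indicator {s..} (cos (x j - t)) *\<^sub>R cis (of_int n * t)))"
      by (simp only: F_def scaleR_sum_left scaleR_scaleR[symmetric])
    also have "\<dots> = (1 / real N) *\<^sub>R (\<Sum>j=1..N. LINT t:{0..<2 * pi}|lborel. indicator {s..} (cos (x j - t)) *\<^sub>R cis (of_int n * t))"
    proof -
      have "(LINT t:{0..<2 * pi}|lborel. (\<Sum>j=1..N. indicat_real {s..} (cos (x j - t)) *\<^sub>R cis (of_int n * t)))
        = (\<Sum>j=1..N. LINT t:{0..<2 * pi}|lborel. indicator {s..} (cos (x j - t)) *\<^sub>R cis (of_int n * t))"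
        unfolding set_lebesgue_integral_def scaleR_sum_right
        using int by (intro Bochner_Integration.integral_sum) (simp add: set_integrable_def)
      then show ?thesis by (simp only: set_integral_scaleR_right)
    qed
    also have "(\<Sum>j=1..N. LINT t:{0..<2 * pi}|lborel. indicat_real {s..} (cos (x j - t)) *\<^sub>R cis (of_int n * t))
       = (\<Sum>j=1..N. cis (of_int n * x j) * c)"
      unfolding s_def c_def using a by (intro sum.cong refl cap_fourier) auto
    finally show "(LINT t:{0..<2 * pi}|lborel. F N t *\<^sub>R cis (of_int n * t))
        = ((1 / real N) *\<^sub>R (\<Sum>j=1..N. cis (of_int n * x j))) * c"
      by (simp add: sum_distrib_right)
  qed
  finally have "(\<lambda>N. ((1 / real N) *\<^sub>R (\<Sum>j=1..N. cis (of_int n * x j))) * c / c) \<longlonglongrightarrow> 0 / c"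
    by (intro tendsto_divide tendsto_const c)
  then show ?thesis by (simp only: nonzero_mult_div_cancel_right[OF c] div_0)
qed

section \<open>From exponential averages to averages of continuous functions\<close>

text \<open>
  Trigonometric polynomials, written with complex exponentials: this makes products of
  monomials monomials again.
\<close>

inductive trig_poly :: "(real \<Rightarrow> complex) \<Rightarrow> bool" where
  monomial: "trig_poly (\<lambda>t. c * cis (of_int n * t))"
| add: "trig_poly f \<Longrightarrow> trig_poly g \<Longrightarrow> trig_poly (\<lambda>t. f t + g t)"

lemma trig_poly_mult_monomial:
  assumes "trig_poly f"
  shows "trig_poly (\<lambda>t. f t * (c * cis (of_int n * t)))"
  using assms
proof induction
  case (monomial d m)
  have "(\<lambda>t. d * cis (of_int m * t) * (c * cis (of_int n * t))) = (\<lambda>t. (d * c) * cis (of_int (m + n) * t))"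
    by (simp add: fun_eq_iff cis_mult[symmetric] distrib_right)
  then show ?case by (metis trig_poly.monomial)
next
  case (add f g)
  then show ?case by (simp add: distrib_right trig_poly.add)
qed

lemma trig_poly_mult:
  assumes "trig_poly g" "trig_poly f"
  shows "trig_poly (\<lambda>t. f t * g t)"
  using assms(1)
proof induction
  case (monomial c n)
  then show ?case by (rule trig_poly_mult_monomial[OF assms(2)])
next
  case (add g h)
  then show ?case by (simp add: distrib_left trig_poly.add)
qed

text \<open>
  A polynomial in the coordinates is a polynomial in \<open>cos t\<close> and \<open>sin t\<close>, both of which are
  combinations of \<open>cis t\<close> and \<open>cis (- t)\<close>.
\<close>

lemma trig_poly_real_polynomial:
  fixes p :: "real^2 \<Rightarrow> real"
  assumes "real_polynomial_function p"
  shows "trig_poly (\<lambda>t. of_real (p (circle_point t)))"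
  using assms
proof induction
  case (linear l)
  interpret bounded_linear l by fact
  define A B where "A = l (axis 1 1)" and "B = l (axis 2 1)"
  have "l (circle_point t) = cos t * A + sin t * B" for t
  proof -
    have "circle_point t = cos t *\<^sub>R axis 1 1 + sin t *\<^sub>R axis 2 1"
      by (simp add: circle_point_def vec_eq_iff forall_2 axis_def)
    then show ?thesis by (simp add: add scaleR A_def B_def)
  qed
  then have "complex_of_real (l (circle_point t))
      = Complex (A / 2) (- B / 2) * cis (of_int 1 * t) + Complex (A / 2) (B / 2) * cis (of_int (- 1) * t)" for t
    by (simp add: complex_eq_iff algebra_simps)
  then show ?case
    by (simp only: trig_poly.intros)
next
  case (const c)
  show ?case using trig_poly.monomial[of "of_real c" 0] by simp
qed (simp_all add: trig_poly.add trig_poly_mult)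

lemma continuous_trig_poly: "trig_poly f \<Longrightarrow> continuous_on A f"
  by (induction rule: trig_poly.induct) (auto intro!: continuous_intros)

lemma trig_poly_average:
  assumes weyl: "\<And>n. n \<noteq> 0 \<Longrightarrow> (\<lambda>N. (1 / real N) *\<^sub>R (\<Sum>j=1..N. cis (of_int n * x j))) \<longlonglongrightarrow> 0"
    and "trig_poly f"
  shows "(\<lambda>N. (1 / real N) *\<^sub>R (\<Sum>j=1..N. f (x j)))
    \<longlonglongrightarrow> (1 / (2 * pi)) *\<^sub>R (LINT t:{0..<2 * pi}|lborel. f t)"
  using assms(2)
proof induction
  case (monomial c n)
  show ?case
  proof (cases "n = 0")
    case True
    have "eventually (\<lambda>N. c = (1 / real N) *\<^sub>R (\<Sum>j=1..N. c * cis (of_int n * x j))) sequentially"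
      using eventually_gt_at_top[of 0]
      by eventually_elim (simp add: True scaleR_conv_of_real)
    then have "(\<lambda>N. (1 / real N) *\<^sub>R (\<Sum>j=1..N. c * cis (of_int n * x j))) \<longlonglongrightarrow> c"
      by (rule Lim_transform_eventually[OF tendsto_const])
    then show ?thesis
      by (simp add: True set_lebesgue_integral_def scaleR_conv_of_real)
  next
    case False
    have "(\<lambda>N. c * ((1 / real N) *\<^sub>R (\<Sum>j=1..N. cis (of_int n * x j)))) \<longlonglongrightarrow> c * 0"
      by (intro tendsto_intros weyl False)
    then show ?thesis
      by (simp add: integral_character_period[OF False] sum_distrib_left)
  qed
next
  case (add f g)
  have int: "set_integrable lborel {0..<2 * pi} h" if "trig_poly h" for h
  proof (rule set_integrable_subset)
    show "set_integrable lborel {0..2 * pi} h"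
      by (intro borel_integrable_atLeastAtMost' continuous_trig_poly that)
  qed auto
  have "(LINT t:{0..<2 * pi}|lborel. f t + g t) = (LINT t:{0..<2 * pi}|lborel. f t) + (LINT t:{0..<2 * pi}|lborel. g t)"
    using add by (intro set_integral_add int)
  then show ?case
    using tendsto_add[OF add.IH] by (simp add: sum.distrib scaleR_add_right)
qed

lemma continuous_circle_prob:
  fixes f :: "real^2 \<Rightarrow> real"
  assumes "continuous_on S1 f"
  shows "f \<in> borel_measurable circle_prob" "integrable circle_prob f"
proof -
  interpret finite_measure circle_prob by (rule finite_measure_circle_prob)
  have "f \<in> borel_measurable (restrict_space borel S1)"
    by (rule borel_measurable_continuous_on_restrict) fact
  then show m: "f \<in> borel_measurable circle_prob"
    by (simp add: circle_prob_def arc_length_def cong: measurable_cong_sets)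
  have "compact (f ` S1)"
    using assms by (intro compact_continuous_image) (auto simp: S1_def)
  then have "\<exists>B. \<forall>y\<in>f ` S1. \<bar>y\<bar> \<le> B"
    by (simp only: bounded_real[symmetric] compact_imp_bounded)
  then obtain B where "\<And>v. v \<in> S1 \<Longrightarrow> \<bar>f v\<bar> \<le> B"
    by blast
  then show "integrable circle_prob f"
    by (intro integrable_const_bound[of _ B] m AE_I2) (auto simp: space_circle_prob)
qed

lemma average_close:
  fixes f g :: "nat \<Rightarrow> real"
  assumes "\<And>j. \<bar>f j - g j\<bar> \<le> e" "0 \<le> e"
  shows "\<bar>(1 / real N) * (\<Sum>j=1..N. f j) - (1 / real N) * (\<Sum>j=1..N. g j)\<bar> \<le> e"
proof -
  have "\<bar>\<Sum>j=1..N. f j - g j\<bar> \<le> (\<Sum>j=1..N. e)"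
    by (rule order_trans[OF sum_abs]) (intro sum_mono assms)
  then have "\<bar>(\<Sum>j=1..N. f j) - (\<Sum>j=1..N. g j)\<bar> \<le> real N * e"
    by (simp add: sum_subtractf)
  moreover have "\<bar>(1 / real N) * (\<Sum>j=1..N. f j) - (1 / real N) * (\<Sum>j=1..N. g j)\<bar>
      = (1 / real N) * \<bar>(\<Sum>j=1..N. f j) - (\<Sum>j=1..N. g j)\<bar>"
    by (simp add: right_diff_distrib[symmetric] abs_mult del: times_divide_eq_left)
  ultimately show ?thesis
    using assms(2) by (cases "N = 0") (auto simp: field_simps)
qed

text \<open>
  Weyl's criterion. By Stone-Weierstrass, a continuous function on the circle is uniformly close to
  a polynomial in the coordinates, and a uniform error of \<open>e / 3\<close> changes both
  the averages and the integral by at most \<open>e / 3\<close>.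
\<close>

lemma continuous_average:
  fixes f :: "real^2 \<Rightarrow> real"
  assumes weyl: "\<And>n. n \<noteq> 0 \<Longrightarrow> (\<lambda>N. (1 / real N) *\<^sub>R (\<Sum>j=1..N. cis (of_int n * x j))) \<longlonglongrightarrow> 0"
    and f: "continuous_on S1 f"
  shows "(\<lambda>N. (1 / real N) * (\<Sum>j=1..N. f (circle_point (x j)))) \<longlonglongrightarrow> integral\<^sup>L circle_prob f"
proof (rule LIMSEQ_I)
  fix e :: real assume "0 < e"
  interpret finite_measure circle_prob by (rule finite_measure_circle_prob)
  obtain p where p: "real_polynomial_function p" "\<And>v. v \<in> S1 \<Longrightarrow> \<bar>f v - p v\<bar> < e / 3"
    using Stone_Weierstrass_real_polynomial_function[of S1 f "e / 3"] f \<open>0 < e\<close>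
    by (auto simp: S1_def)
  have pc: "continuous_on S1 p"
    by (intro continuous_at_imp_continuous_on ballI continuous_real_polymonial_function p(1))
  have "(\<lambda>N. (1 / real N) * (\<Sum>j=1..N. p (circle_point (x j)))) \<longlonglongrightarrow> integral\<^sup>L circle_prob p"
  proof -
    have "(\<lambda>N. (1 / real N) *\<^sub>R (\<Sum>j=1..N. complex_of_real (p (circle_point (x j)))))
      \<longlonglongrightarrow> (1 / (2 * pi)) *\<^sub>R (LINT t:{0..<2 * pi}|lborel. complex_of_real (p (circle_point t)))"
      by (rule trig_poly_average[OF weyl trig_poly_real_polynomial[OF p(1)]])
    also have "(1 / (2 * pi)) *\<^sub>R (LINT t:{0..<2 * pi}|lborel. complex_of_real (p (circle_point t)))
       = complex_of_real (integral\<^sup>L circle_prob p)"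
      by (simp add: integral_circle_prob[OF continuous_circle_prob(1)[OF pc]]
          set_integral_complex_of_real scaleR_conv_of_real)
    also have "(\<lambda>N. (1 / real N) *\<^sub>R (\<Sum>j=1..N. complex_of_real (p (circle_point (x j)))))
       = (\<lambda>N. complex_of_real ((1 / real N) * (\<Sum>j=1..N. p (circle_point (x j)))))"
      by (simp add: scaleR_conv_of_real)
    finally show ?thesis by (simp only: tendsto_of_real_iff)
  qed
  from LIMSEQ_D[OF this, of "e / 3"] \<open>0 < e\<close>
  obtain N0 where N0: "\<And>N. N \<ge> N0 \<Longrightarrow>
      \<bar>(1 / real N) * (\<Sum>j=1..N. p (circle_point (x j))) - integral\<^sup>L circle_prob p\<bar> < e / 3"
    by auto
  have "\<bar>integral\<^sup>L circle_prob f - integral\<^sup>L circle_prob p\<bar> \<le> e / 3"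
  proof -
    have "integral\<^sup>L circle_prob f - integral\<^sup>L circle_prob p = integral\<^sup>L circle_prob (\<lambda>v. f v - p v)"
      by (intro Bochner_Integration.integral_diff[symmetric] continuous_circle_prob f pc)
    also have "norm \<dots> \<le> integral\<^sup>L circle_prob (\<lambda>v. e / 3)"
    proof (rule Bochner_Integration.integral_norm_bound_integral)
      show "integrable circle_prob (\<lambda>v. f v - p v)"
        by (intro Bochner_Integration.integrable_diff continuous_circle_prob f pc)
      show "norm (f v - p v) \<le> e / 3" if "v \<in> space circle_prob" for v
        using p(2)[of v] that by (simp add: space_circle_prob)
    qed simp
    also have "\<dots> = e / 3"
      by (simp add: space_circle_prob measure_def emeasure_circle_prob_S1)
    finally show ?thesis by simp
  qed
  moreover have close: "\<bar>(1 / real N) * (\<Sum>j=1..N. f (circle_point (x j)))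
      - (1 / real N) * (\<Sum>j=1..N. p (circle_point (x j)))\<bar> \<le> e / 3" for N
    using p(2) \<open>0 < e\<close> by (intro average_close) (auto simp: circle_point_in_S1 less_imp_le)
  ultimately have "norm ((1 / real N) * (\<Sum>j=1..N. f (circle_point (x j))) - integral\<^sup>L circle_prob f) < e"
    if "N \<ge> N0" for N
    using N0[OF that] close[of N] unfolding real_norm_def by linarith
  then show "\<exists>no. \<forall>N\<ge>no. norm ((1 / real N) * (\<Sum>j=1..N. f (circle_point (x j))) - integral\<^sup>L circle_prob f) < e"
    by blast
qed

section \<open>From continuous functions to continuity sets\<close>

text \<open>
  The boundary in the definition of continuity sets is relative to the circle. Since the circle is
  closed, the closure of a subset is the same in the circle and in the plane.
\<close>

lemma frontier_of_S1:
  assumes "A \<subseteq> S1"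
  shows "closure A \<subseteq> A \<union> (top_of_set S1 frontier_of A)"
    and "top_of_set S1 frontier_of A \<subseteq> closure A"
    and "top_of_set S1 frontier_of A \<in> sets circle_prob"
    and "closure A \<in> sets circle_prob"
proof -
  have S1: "closed S1" by (simp add: S1_def)
  have cl: "closure A \<subseteq> S1" using assms S1 by (rule closure_minimal)
  have cof: "top_of_set S1 closure_of A = closure A"
    using assms cl by (auto simp: closure_of_subtopology Int_absorb1)
  show "closure A \<subseteq> A \<union> (top_of_set S1 frontier_of A)"
    using interior_of_subset[of "top_of_set S1" A] by (auto simp: frontier_of_def cof)
  show sub: "top_of_set S1 frontier_of A \<subseteq> closure A"
    by (auto simp: frontier_of_def cof)
  have "closed (top_of_set S1 frontier_of A)"
    using closedin_frontier_of[of "top_of_set S1" A] S1 by (metis closedin_closed_trans)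
  then show "top_of_set S1 frontier_of A \<in> sets circle_prob"
    using sub cl by (auto simp: sets_circle_prob)
  show "closure A \<in> sets circle_prob"
    using cl by (auto simp: sets_circle_prob)
qed

lemma measure_closure_continuity_set:
  assumes "is_continuity_set A"
  shows "measure circle_prob (closure A) \<le> measure circle_prob A"
proof -
  interpret finite_measure circle_prob by (rule finite_measure_circle_prob)
  have A: "A \<in> sets circle_prob" "A \<subseteq> S1" "measure circle_prob (top_of_set S1 frontier_of A) = 0"
    using assms by (auto simp: is_continuity_set_def sets_circle_prob)
  have "measure circle_prob (closure A) \<le> measure circle_prob (A \<union> (top_of_set S1 frontier_of A))"
    by (intro finite_measure_mono frontier_of_S1 sets.Un A)
  also have "\<dots> \<le> measure circle_prob A + measure circle_prob (top_of_set S1 frontier_of A)"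
    by (intro measure_Un_le frontier_of_S1 A)
  finally show ?thesis using A by simp
qed

text \<open>
  The continuous functions \<open>g k\<close> below lie above the indicator of \<open>A\<close> and converge to the indicator
  of its closure, which has no larger measure than \<open>A\<close>; so some \<open>g k\<close> has an integral just above the
  measure of \<open>A\<close>, and its averages bound the frequency of \<open>A\<close>.
\<close>

lemma frequency_upper_bound:
  assumes avg: "\<And>f :: real^2 \<Rightarrow> real. continuous_on S1 f \<Longrightarrow>
      (\<lambda>N. (1 / real N) * (\<Sum>j=1..N. f (u j))) \<longlonglongrightarrow> integral\<^sup>L circle_prob f"
    and A: "is_continuity_set A" and "0 < e"
  shows "eventually (\<lambda>N. (1 / real N) * (\<Sum>j=1..N. indicat_real A (u j)) < measure circle_prob A + e) sequentially"
proof (cases "A = {}")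
  case True
  \<comment> \<open>Separate, because \<open>infdist\<close> to the empty set is 0 by convention.\<close>
  then show ?thesis using \<open>0 < e\<close> by simp
next
  case False
  interpret finite_measure circle_prob by (rule finite_measure_circle_prob)
  define g where "g k v = max 0 (1 - real k * infdist v (closure A))" for k and v :: "real^2"
  have gc: "continuous_on S1 (g k)" for k
    unfolding g_def by (intro continuous_intros)
  have gA: "indicat_real A v \<le> g k v" for k v
    using closure_subset[of A] by (auto simp: g_def indicator_def)
  have lim: "(\<lambda>k. g k v) \<longlonglongrightarrow> indicat_real (closure A) v" for v
  proof (cases "v \<in> closure A")
    case True
    then show ?thesis by (simp add: g_def)
  next
    case nin: False
    then have pos: "infdist v (closure A) > 0"
      using infdist_pos_not_in_closed[of "closure A" v] False by simp
    obtain k0 :: nat where "1 / infdist v (closure A) < k0"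
      using reals_Archimedean2 by blast
    then have "1 < real k0 * infdist v (closure A)"
      using pos by (simp add: divide_less_eq)
    moreover have "real k0 * infdist v (closure A) \<le> real k * infdist v (closure A)" if "k \<ge> k0" for k
      using that by (intro mult_right_mono) (simp_all add: infdist_nonneg)
    ultimately have "1 \<le> real k * infdist v (closure A)" if "k \<ge> k0" for k
      using that by (meson less_imp_le less_le_trans)
    then have "eventually (\<lambda>k. indicat_real (closure A) v = g k v) sequentially"
      using nin by (auto simp: g_def eventually_sequentially intro!: exI[of _ k0])
    then show ?thesis by (rule Lim_transform_eventually[OF tendsto_const])
  qed
  have cl: "closure A \<in> sets circle_prob"
    using A by (intro frontier_of_S1) (auto simp: is_continuity_set_def sets_circle_prob)
  have "(\<lambda>k. integral\<^sup>L circle_prob (g k)) \<longlonglongrightarrow> integral\<^sup>L circle_prob (indicat_real (closure A))"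
  proof (rule integral_dominated_convergence[where w="\<lambda>_. 1"])
    show "AE v in circle_prob. norm (g k v) \<le> 1" for k
      by (auto simp: g_def infdist_nonneg)
  qed (use lim cl continuous_circle_prob(1)[OF gc] in auto)
  then have "(\<lambda>k. integral\<^sup>L circle_prob (g k)) \<longlonglongrightarrow> measure circle_prob (closure A)"
    using cl by simp
  moreover have "measure circle_prob (closure A) < measure circle_prob A + e"
    using measure_closure_continuity_set[OF A] \<open>0 < e\<close> by simp
  ultimately have "eventually (\<lambda>k. integral\<^sup>L circle_prob (g k) < measure circle_prob A + e) sequentially"
    by (rule order_tendstoD(2))
  then obtain k where k: "integral\<^sup>L circle_prob (g k) < measure circle_prob A + e"
    using eventually_happens'[OF sequentially_bot] by blast
  have "eventually (\<lambda>N. (1 / real N) * (\<Sum>j=1..N. g k (u j)) < measure circle_prob A + e) sequentially"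
    using avg[OF gc] k by (rule order_tendstoD(2))
  then show ?thesis
  proof eventually_elim
    case (elim N)
    have "(1 / real N) * (\<Sum>j=1..N. indicat_real A (u j)) \<le> (1 / real N) * (\<Sum>j=1..N. g k (u j))"
      by (intro mult_left_mono sum_mono gA) simp
    with elim show ?case by simp
  qed
qed

text \<open>
  The complement of a continuity set is a continuity set, and its upper bound is a lower bound for
  the set itself.
\<close>

lemma uniformly_distributed_if_continuous_averages:
  assumes avg: "\<And>f :: real^2 \<Rightarrow> real. continuous_on S1 f \<Longrightarrow>
      (\<lambda>N. (1 / real N) * (\<Sum>j=1..N. f (u j))) \<longlonglongrightarrow> integral\<^sup>L circle_prob f"
    and u: "\<And>j. j \<ge> 1 \<Longrightarrow> u j \<in> S1"
  shows "uniformly_distributed u"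
  unfolding uniformly_distributed_def has_frequency_def
proof (intro allI impI)
  fix A assume A: "is_continuity_set A"
  interpret finite_measure circle_prob by (rule finite_measure_circle_prob)
  have A': "A \<in> sets circle_prob" "A \<subseteq> S1"
    using A by (auto simp: is_continuity_set_def sets_circle_prob)
  have comp: "is_continuity_set (S1 - A)"
    using A sets.compl_sets[OF A'(1)] frontier_of_complement[of "top_of_set S1" A]
    by (simp add: is_continuity_set_def space_circle_prob)
  have mcomp: "measure circle_prob (S1 - A) = 1 - measure circle_prob A"
    using finite_measure_compl[OF A'(1)]
    by (simp add: space_circle_prob measure_def emeasure_circle_prob_S1)
  show "(\<lambda>N. (1 / real N) * (\<Sum>j=1..N. indicat_real A (u j))) \<longlonglongrightarrow> measure circle_prob A"
  proof (rule tendstoI)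
    fix e :: real assume "0 < e"
    have eA: "eventually (\<lambda>N. (1 / real N) * (\<Sum>j=1..N. indicat_real A (u j)) < measure circle_prob A + e) sequentially"
      by (rule frequency_upper_bound[OF _ A \<open>0 < e\<close>]) (rule avg)
    have eC: "eventually (\<lambda>N. (1 / real N) * (\<Sum>j=1..N. indicat_real (S1 - A) (u j)) < measure circle_prob (S1 - A) + e) sequentially"
      by (rule frequency_upper_bound[OF _ comp \<open>0 < e\<close>]) (rule avg)
    show "eventually (\<lambda>N. dist ((1 / real N) * (\<Sum>j=1..N. indicat_real A (u j))) (measure circle_prob A) < e) sequentially"
      using eA eC eventually_gt_at_top[of 0]
    proof eventually_elim
      case (elim N)
      have "(\<Sum>j=1..N. indicat_real (S1 - A) (u j)) = (\<Sum>j=1..N. 1 - indicat_real A (u j))"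
        using u by (intro sum.cong) (auto simp: indicator_def)
      then have "(1 / real N) * (\<Sum>j=1..N. indicat_real (S1 - A) (u j))
          = 1 - (1 / real N) * (\<Sum>j=1..N. indicat_real A (u j))"
        using elim(3) by (simp add: sum_subtractf diff_divide_distrib)
      with elim show ?case unfolding mcomp dist_real_def by linarith
    qed
  qed
qed

section \<open>Countable sets of points on the circle\<close>

lemma continuous_on_circle_point: "continuous_on A circle_point"
proof -
  have eq: "circle_point = (\<lambda>t. cos t *\<^sub>R axis 1 1 + sin t *\<^sub>R axis 2 1)"
    by (simp add: fun_eq_iff circle_point_def vec_eq_iff forall_2 axis_def)
  show ?thesis unfolding eq by (intro continuous_intros)
qed

text \<open>
  Only countably many angles in one turn lead into a countable set, and these have Lebesgue
  measure 0.
\<close>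

lemma measure_countable:
  assumes "countable A" "A \<subseteq> S1"
  shows "measure circle_prob A = 0"
proof -
  have "A \<in> sets circle_prob"
    using assms by (simp add: sets_circle_prob sets.countable)
  define T where "T = {t \<in> {0..<2 * pi}. circle_point t \<in> A}"
  have "inj_on circle_point T"
    using bij_betw_imp_inj_on[OF bij_betw_circle_point] by (rule inj_on_subset) (auto simp: T_def)
  moreover have "countable (circle_point ` T)"
    using assms(1) by (rule countable_subset[rotated]) (auto simp: T_def)
  ultimately have "countable T" by (rule countable_image_inj_on[rotated])
  have "(LINT t:{0..<2 * pi}|lborel. indicat_real A (circle_point t)) = (LINT t|lborel. indicat_real T t)"
    unfolding set_lebesgue_integral_def
    by (intro Bochner_Integration.integral_cong) (auto simp: T_def indicator_def)
  also have "\<dots> = 0"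
    using countable_imp_null_set_lborel[OF \<open>countable T\<close>] by (simp add: measure_def null_setsD1)
  finally show ?thesis
    by (simp add: measure_circle_prob_eq_integral[OF \<open>A \<in> sets circle_prob\<close>])
qed

lemma is_continuity_set_countable_closed:
  assumes "countable A" "closed A" "A \<subseteq> S1"
  shows "is_continuity_set A"
proof -
  have "top_of_set S1 frontier_of A \<subseteq> A"
    using frontier_of_S1(2)[OF assms(3)] assms(2) by simp
  then show ?thesis
    using assms by (auto simp: is_continuity_set_def sets_circle_prob intro!: measure_countable
      intro: countable_subset)
qed

section \<open>Vertices of a regular polygon in a closed arc\<close>

lemma cos_pi_le_cos_iff_ex:
  assumes "0 \<le> b" "b \<le> 1"
  shows "cos (pi * b) \<le> cos t \<longleftrightarrow> (\<exists>i::int. \<bar>t - 2 * pi * of_int i\<bar> \<le> pi * b)"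
proof -
  have shift: "cos (t - 2 * pi * of_int i) = cos t" for i :: int
    by (simp add: cos_diff)
  show ?thesis
  proof
    assume L: "cos (pi * b) \<le> cos t"
    define i where "i = round (t / (2 * pi))"
    have "\<bar>of_int i - t / (2 * pi)\<bar> * (2 * pi) \<le> 1 / 2 * (2 * pi)"
      unfolding i_def by (intro mult_right_mono of_int_round_abs_le) simp
    also have "\<bar>of_int i - t / (2 * pi)\<bar> * (2 * pi) = \<bar>(of_int i - t / (2 * pi)) * (2 * pi)\<bar>"
      by (simp add: abs_mult)
    also have "(of_int i - t / (2 * pi)) * (2 * pi) = - (t - 2 * pi * of_int i)"
      by (simp add: field_simps)
    finally have "\<bar>t - 2 * pi * of_int i\<bar> \<le> pi" by simp
    then have "\<bar>t - 2 * pi * of_int i\<bar> \<le> pi * b"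
      using cos_pi_le_cos_iff[OF assms] L shift by metis
    then show "\<exists>i::int. \<bar>t - 2 * pi * of_int i\<bar> \<le> pi * b" ..
  next
    assume "\<exists>i::int. \<bar>t - 2 * pi * of_int i\<bar> \<le> pi * b"
    then obtain i :: int where i: "\<bar>t - 2 * pi * of_int i\<bar> \<le> pi * b" ..
    have "pi * b \<le> pi" using assms by (simp add: mult_left_le)
    with i have "\<bar>t - 2 * pi * of_int i\<bar> \<le> pi" by linarith
    from cos_pi_le_cos_iff[OF assms this] i show "cos (pi * b) \<le> cos t"
      unfolding shift by blast
  qed
qed

text \<open>
  A window of \<open>L \<le> q\<close> consecutive integers starting at \<open>b\<close> represents \<open>L\<close> different residue
  classes modulo \<open>q\<close>; the bijection sends the \<open>r\<close>-th integer of the window to its residue.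
\<close>

lemma card_residues_in_window:
  fixes b :: int and q L :: nat
  assumes "L \<le> q"
  shows "card {k \<in> {..<q}. \<exists>i::int. b \<le> int k - int q * i \<and> int k - int q * i < b + int L} = L"
proof (cases "q = 0")
  case True
  then show ?thesis using assms by simp
next
  case False
  let ?K = "{k \<in> {..<q}. \<exists>i::int. b \<le> int k - int q * i \<and> int k - int q * i < b + int L}"
  have q: "int q > 0" using False by simp
  have "bij_betw (\<lambda>r. nat ((b + int r) mod int q)) {..<L} ?K"
  proof (rule bij_betw_byWitness[where f' = "\<lambda>k. nat ((int k - b) mod int q)"])
    show "\<forall>r\<in>{..<L}. nat ((int (nat ((b + int r) mod int q)) - b) mod int q) = r"
    proof
      fix r assume "r \<in> {..<L}"
      then have r: "int r < int q" using assms by simp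
      have "(int (nat ((b + int r) mod int q)) - b) mod int q = ((b + int r) - b) mod int q"
        using q by (simp add: mod_diff_left_eq)
      also have "\<dots> = int r" using r by simp
      finally show "nat ((int (nat ((b + int r) mod int q)) - b) mod int q) = r" by simp
    qed
    show "\<forall>k\<in>?K. nat ((b + int (nat ((int k - b) mod int q))) mod int q) = k"
    proof
      fix k assume "k \<in> ?K"
      then have k: "int k < int q" by simp
      have "(b + int (nat ((int k - b) mod int q))) mod int q = (b + (int k - b)) mod int q"
        using q by (simp add: mod_add_right_eq)
      also have "\<dots> = int k" using k by simp
      finally show "nat ((b + int (nat ((int k - b) mod int q))) mod int q) = k" by simp
    qed
    show "(\<lambda>r. nat ((b + int r) mod int q)) ` {..<L} \<subseteq> ?K"
    proof safe
      fix r assume r: "r < L"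
      have m: "0 \<le> (b + int r) mod int q" "(b + int r) mod int q < int q" using q by auto
      then show "nat ((b + int r) mod int q) < q" by linarith
      have "(b + int r) mod int q - int q * (- ((b + int r) div int q)) = b + int r"
        by (simp add: algebra_simps)
      then show "\<exists>i. b \<le> int (nat ((b + int r) mod int q)) - int q * i \<and>
          int (nat ((b + int r) mod int q)) - int q * i < b + int L"
        using r m by (intro exI[of _ "- ((b + int r) div int q)"]) simp
    qed
    show "(\<lambda>k. nat ((int k - b) mod int q)) ` ?K \<subseteq> {..<L}"
    proof safe
      fix k i assume k: "k < q" "b \<le> int k - int q * i" "int k - int q * i < b + int L"
      have "(int k - b) mod int q = ((int k - b - int q * i) + int q * i) mod int q" by simp
      also have "\<dots> = (int k - b - int q * i) mod int q" by (rule mod_mult_self2)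
      also have "\<dots> = int k - b - int q * i"
        using k assms by (intro mod_pos_pos_trivial) auto
      finally show "nat ((int k - b) mod int q) < L" using k by simp
    qed
  qed
  from bij_betw_same_card[OF this] show ?thesis by simp
qed

text \<open>
  On a circle of circumference \<open>q\<close>, this counts the points \<open>k + \<beta>\<close> of an equally spaced \<open>q\<close>-gon in the
  closed arc from 0 to \<open>p\<close>. The integers between \<open>- \<beta>\<close> and \<open>p - \<beta>\<close> number \<open>p\<close>, or \<open>p + 1\<close> when the two
  endpoints are integers themselves.
\<close>

lemma card_translates_in_closed_arc:
  fixes \<beta> :: real and p q :: nat
  assumes "p < q"
  shows "card {k \<in> {..<q}. \<exists>i::int. 0 \<le> real k + \<beta> - real q * of_int i \<and> real k + \<beta> - real q * of_int i \<le> real p}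
    = p + (if \<beta> \<in> \<int> then 1 else 0)"
proof -
  define b where "b = \<lceil>- \<beta>\<rceil>"
  define L where "L = p + (if \<beta> \<in> \<int> then 1 else 0)"
  have "(0 \<le> real k + \<beta> - real q * of_int i \<and> real k + \<beta> - real q * of_int i \<le> real p)
     \<longleftrightarrow> (b \<le> int k - int q * i \<and> int k - int q * i < b + int L)" for k :: nat and i :: int
  proof -
    define z where "z = int k - int q * i"
    have z: "real k - real q * of_int i = of_int z" by (simp add: z_def)
    have "(0 \<le> of_int z + \<beta> \<and> of_int z + \<beta> \<le> real p) \<longleftrightarrow> (b \<le> z \<and> z < b + int L)"
    proof (cases "\<beta> \<in> \<int>")
      case True
      then obtain n :: int where "\<beta> = of_int n" by (auto elim: Ints_cases)
      moreover have "\<lceil>- real_of_int n\<rceil> = - n"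
        by (metis ceiling_of_int of_int_minus)
      moreover have "0 \<le> real_of_int z + of_int n \<longleftrightarrow> 0 \<le> z + n"
        by (simp flip: of_int_add)
      moreover have "real_of_int z + of_int n \<le> real p \<longleftrightarrow> z + n \<le> int p"
        by (metis of_int_add of_int_le_iff of_int_of_nat_eq)
      ultimately show ?thesis by (auto simp: b_def L_def)
    next
      case False
      have ne: "\<beta> \<noteq> of_int y" for y :: int using False by auto
      have "\<lceil>- \<beta>\<rceil> \<le> z \<longleftrightarrow> 0 \<le> of_int z + \<beta>"
        by (simp add: ceiling_le_iff) linarith
      moreover have "z < \<lceil>- \<beta>\<rceil> + int p \<longleftrightarrow> of_int z + \<beta> < real p"
        using less_ceiling_iff[of "z - int p" "- \<beta>"] by (simp add: algebra_simps)
      moreover have "of_int z + \<beta> \<noteq> real p"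
        using ne[of "int p - z"] by auto
      ultimately show ?thesis using False by (auto simp: b_def L_def)
    qed
    then show ?thesis unfolding z_def[symmetric] using z by (simp add: algebra_simps)
  qed
  then have "card {k \<in> {..<q}. \<exists>i::int. 0 \<le> real k + \<beta> - real q * of_int i \<and> real k + \<beta> - real q * of_int i \<le> real p}
    = card {k \<in> {..<q}. \<exists>i::int. b \<le> int k - int q * i \<and> int k - int q * i < b + int L}"
    by simp
  also have "\<dots> = L"
    using assms by (intro card_residues_in_window) (simp add: L_def)
  finally show ?thesis by (simp add: L_def)
qed

section \<open>A sequence running through converging regular polygons\<close>

text \<open>
  The index \<open>m * q + k\<close> with \<open>k < q\<close> denotes vertex \<open>k\<close> of the \<open>m\<close>-th regular \<open>q\<close>-gon, which is turned by
  the fraction \<open>1 / (m + 2)\<close> of the angle between neighbouring vertices. These fractions are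
  distinct and lie strictly between 0 and 1, so no two of the polygons share a vertex.
\<close>

definition drifting_polygon_angle :: "nat \<Rightarrow> nat \<Rightarrow> real" where
  "drifting_polygon_angle q j = 2 * pi * (real (j mod q) + 1 / real (j div q + 2)) / real q"

text \<open>
  Measured in units of the angle \<open>2 * pi / q\<close> between neighbouring vertices and starting from the
  beginning of the cap, the cap is the interval from 0 to \<open>p\<close> and the \<open>k\<close>-th vertex is \<open>k + \<beta>\<close>.
\<close>

lemma drifting_polygon_block_count:
  fixes p q m :: nat and \<phi> :: real
  assumes pq: "p < q"
  shows "(\<Sum>k<q. indicat_real (cap \<phi> (cos (pi * (real p / real q)))) (circle_point (drifting_polygon_angle q (m * q + k))))
    = real p + (if 1 / real (m + 2) + (real p / 2 - real q * \<phi> / (2 * pi)) \<in> \<int> then 1 else 0)"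
proof -
  define \<beta> where "\<beta> = 1 / real (m + 2) + (real p / 2 - real q * \<phi> / (2 * pi))"
  let ?P = "\<lambda>k. \<exists>i::int. 0 \<le> real k + \<beta> - real q * of_int i \<and> real k + \<beta> - real q * of_int i \<le> real p"
  have q: "real q > 0" using pq by simp
  have ind: "indicat_real (cap \<phi> (cos (pi * (real p / real q)))) (circle_point (drifting_polygon_angle q (m * q + k)))
     = (if ?P k then 1 else 0)" if "k < q" for k
  proof -
    define t where "t = drifting_polygon_angle q (m * q + k) - \<phi>"
    define r where "r = 1 / real (m + 2)"
    have "drifting_polygon_angle q (m * q + k) = 2 * pi * (real k + r) / real q"
      using \<open>k < q\<close> by (simp add: drifting_polygon_angle_def r_def)
    moreover have "\<beta> = r + (real p / 2 - real q * \<phi> / (2 * pi))"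
      by (simp only: \<beta>_def r_def)
    ultimately have t: "t = 2 * pi / real q * (real k + \<beta> - real p / 2)"
      using q by (simp add: t_def field_simps)
    have "\<bar>t - 2 * pi * of_int i\<bar> \<le> pi * (real p / real q) \<longleftrightarrow>
       0 \<le> real k + \<beta> - real q * of_int i \<and> real k + \<beta> - real q * of_int i \<le> real p" for i :: int
    proof -
      define y where "y = real k + \<beta> - real q * of_int i - real p / 2"
      have "t - 2 * pi * of_int i = 2 * pi / real q * y"
        using q by (simp add: t y_def field_simps)
      moreover have "pi * (real p / real q) = 2 * pi / real q * (real p / 2)" by simp
      ultimately have "\<bar>t - 2 * pi * of_int i\<bar> \<le> pi * (real p / real q) \<longleftrightarrow> \<bar>y\<bar> \<le> real p / 2"
        using q by (simp only: abs_mult) (simp add: divide_le_cancel mult.commute)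
      also have "\<dots> \<longleftrightarrow> 0 \<le> real k + \<beta> - real q * of_int i \<and> real k + \<beta> - real q * of_int i \<le> real p"
        unfolding y_def by linarith
      finally show ?thesis .
    qed
    moreover have "circle_point (drifting_polygon_angle q (m * q + k)) \<in> cap \<phi> (cos (pi * (real p / real q)))
       \<longleftrightarrow> (\<exists>i::int. \<bar>t - 2 * pi * of_int i\<bar> \<le> pi * (real p / real q))"
      unfolding circle_point_in_cap_iff t_def using pq by (intro cos_pi_le_cos_iff_ex) auto
    ultimately show ?thesis by (simp add: indicator_def)
  qed
  have "(\<Sum>k<q. indicat_real (cap \<phi> (cos (pi * (real p / real q)))) (circle_point (drifting_polygon_angle q (m * q + k))))
    = (\<Sum>k<q. if ?P k then 1 else 0)"
    using ind by (intro sum.cong) auto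
  also have "\<dots> = real (card {k \<in> {..<q}. ?P k})"
    by (simp add: sum.If_cases Int_def)
  also have "\<dots> = real (p + (if \<beta> \<in> \<int> then 1 else 0))"
    by (simp only: card_translates_in_closed_arc[OF pq])
  finally show ?thesis by (simp add: \<beta>_def)
qed

text \<open>
  The numbers \<open>1 / (m + 2)\<close> lie strictly between 0 and 1, so two of them that differ by an integer
  are equal. Hence a cap has vertices at its endpoints for at most one of the polygons.
\<close>

lemma card_shifted_reciprocals_integer:
  "card {m \<in> {..<M}. 1 / real (m + 2) + \<gamma> \<in> \<int>} \<le> 1"
proof -
  have "m = m'" if "1 / real (m + 2) + \<gamma> \<in> \<int>" "1 / real (m' + 2) + \<gamma> \<in> \<int>" for m m' :: nat
  proof -
    have "(1 / real (m + 2) + \<gamma>) - (1 / real (m' + 2) + \<gamma>) \<in> \<int>"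
      using that by (rule Ints_diff)
    then obtain z :: int where z: "1 / real (m + 2) - 1 / real (m' + 2) = of_int z"
      by (auto elim: Ints_cases)
    have "0 < 1 / real (n + 2)" "1 / real (n + 2) < 1" for n by auto
    from this[of m] this[of m'] have "\<bar>real_of_int z\<bar> < 1" using z by linarith
    then have "z = 0" by linarith
    with z show ?thesis by simp
  qed
  then show ?thesis by (subst card_le_Suc0_iff_eq[simplified One_nat_def[symmetric]]) auto
qed

text \<open>
  Each complete polygon contributes \<open>p\<close> hits, apart from one extra hit for at most one polygon. So
  the number of hits among the first \<open>N\<close> points differs from \<open>N * p / q\<close> by a bounded amount.
\<close>

lemma drifting_polygon_frequency:
  fixes p q :: nat
  assumes pq: "p < q"
  shows "has_frequency (\<lambda>j. circle_point (drifting_polygon_angle q j))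
    (cap \<phi> (cos (pi * (real p / real q)))) (real p / real q)"
proof -
  define f where "f j = indicat_real (cap \<phi> (cos (pi * (real p / real q)))) (circle_point (drifting_polygon_angle q j))" for j
  define S where "S n = (\<Sum>j<n. f j)" for n
  define a where "a = real p / real q"
  have f: "0 \<le> f j" "f j \<le> 1" for j by (auto simp: f_def indicator_def)
  have a: "0 \<le> a" "a \<le> 1" "a * real q = real p" using pq by (auto simp: a_def)
  have mono: "S m \<le> S n" if "m \<le> n" for m n
    unfolding S_def using that by (intro sum_mono2) (auto simp: f)
  have block: "real p * real M \<le> S (M * q)" "S (M * q) \<le> real p * real M + 1" for M
  proof -
    define \<gamma> where "\<gamma> = real p / 2 - real q * \<phi> / (2 * pi)"
    have "S (M * q) = (\<Sum>m<M. sum f {m * q..<m * q + q})"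
      unfolding S_def by (rule sum.nat_group[symmetric])
    also have "\<dots> = (\<Sum>m<M. \<Sum>k<q. f (m * q + k))"
    proof (rule sum.cong[OF refl])
      fix m
      show "sum f {m * q..<m * q + q} = (\<Sum>k<q. f (m * q + k))"
        using sum.shift_bounds_nat_ivl[of f 0 "m * q" q] by (simp add: atLeast0LessThan add.commute)
    qed
    also have "\<dots> = (\<Sum>m<M. real p + (if 1 / real (m + 2) + \<gamma> \<in> \<int> then 1 else 0))"
      unfolding f_def \<gamma>_def drifting_polygon_block_count[OF pq] ..
    also have "\<dots> = real p * real M + real (card {m \<in> {..<M}. 1 / real (m + 2) + \<gamma> \<in> \<int>})"
      by (simp add: sum.distrib sum.If_cases Int_def)
    finally have *: "S (M * q) = real p * real M + real (card {m \<in> {..<M}. 1 / real (m + 2) + \<gamma> \<in> \<int>})" .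
    show "real p * real M \<le> S (M * q)" "S (M * q) \<le> real p * real M + 1"
      unfolding * using card_shifted_reciprocals_integer[of M \<gamma>] by simp_all
  qed
  \<comment> \<open>\<open>N + 1\<close> points, counting index 0, make \<open>M\<close> complete polygons and a part of one more. The bound
    allows \<open>p\<close> for that part, 1 for the extra hit, 1 for index 0 and \<open>a \<le> 1\<close> for
    passing from \<open>N + 1\<close> to \<open>N\<close>.\<close>
  have disc: "\<bar>(\<Sum>j=1..N. f j) - a * real N\<bar> \<le> real p + 3" for N
  proof -
    define M where "M = Suc N div q"
    have M: "M * q \<le> Suc N" "Suc N \<le> Suc M * q"
      using pq div_times_less_eq_dividend[of "Suc N" q] dividend_less_div_times[of q "Suc N"]
      by (auto simp: M_def)
    have lower: "real p * real M \<le> S (Suc N)"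
      using block(1)[of M] mono[OF M(1)] by linarith
    have upper: "S (Suc N) \<le> real p * real M + real p + 1"
      using block(2)[of "Suc M"] mono[OF M(2)] by (simp add: algebra_simps)
    have "a * real (M * q) \<le> a * real (Suc N)" "a * real (Suc N) \<le> a * real (Suc M * q)"
      using M a(1) by (intro mult_left_mono; simp only: of_nat_le_iff)+
    moreover have e: "a * real (n * q) = real n * (a * real q)" for n
      by simp
    have "a * real (M * q) = real p * real M" "a * real (Suc M * q) = real p * real M + real p"
      unfolding e a(3) by (simp_all add: algebra_simps)
    moreover have "a * real (Suc N) = a * real N + a"
      by (simp add: algebra_simps)
    ultimately have aN: "real p * real M \<le> a * real N + a" "a * real N + a \<le> real p * real M + real p"
      by linarith+
    have "S (Suc N) = f 0 + (\<Sum>j=1..N. f j)"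
      unfolding S_def using sum.lessThan_Suc_shift[of f N]
      by (simp add: sum.atLeast1_atMost_eq)
    then show ?thesis using lower upper aN f[of 0] a(1,2) by linarith
  qed
  have "(\<lambda>N. (1 / real N) * (\<Sum>j=1..N. f j)) \<longlonglongrightarrow> a"
  proof (rule metric_LIMSEQ_I)
    fix e :: real assume "0 < e"
    obtain n0 :: nat where n0: "(real p + 3) / e < n0" using reals_Archimedean2 by blast
    have "dist ((1 / real N) * (\<Sum>j=1..N. f j)) a < e" if "N \<ge> n0" for N
    proof -
      have N: "real N > (real p + 3) / e" using n0 that by linarith
      moreover have "(real p + 3) / e > 0" using \<open>0 < e\<close> by simp
      ultimately have N0: "real N > 0" by linarith
      have "(1 / real N) * (\<Sum>j=1..N. f j) - a = ((\<Sum>j=1..N. f j) - a * real N) / real N"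
        using N0 by (simp add: field_simps)
      then have "dist ((1 / real N) * (\<Sum>j=1..N. f j)) a = \<bar>(\<Sum>j=1..N. f j) - a * real N\<bar> / real N"
        by (simp add: dist_real_def)
      also have "\<dots> \<le> (real p + 3) / real N"
        by (intro divide_right_mono disc) simp
      also have "\<dots> < e" using N N0 \<open>0 < e\<close> by (simp add: field_simps)
      finally show ?thesis .
    qed
    then show "\<exists>n0. \<forall>N\<ge>n0. dist ((1 / real N) * (\<Sum>j=1..N. f j)) a < e" by blast
  qed
  then show ?thesis by (simp only: has_frequency_def f_def a_def)
qed

text \<open>
  The vertices of all polygons together with those of their limit form a countable compact set.
\<close>

lemma drifting_polygon_not_uniformly_distributed:
  assumes "0 < q"
  shows "\<not> uniformly_distributed (\<lambda>j. circle_point (drifting_polygon_angle q j))"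
proof
  assume ud: "uniformly_distributed (\<lambda>j. circle_point (drifting_polygon_angle q j))"
  define T where "T = insert 0 (range (\<lambda>m. 1 / real (m + 2)))"
  define A where "A = (\<Union>k<q. (\<lambda>s. circle_point (2 * pi * (real k + s) / real q)) ` T)"
  have "(\<lambda>m. 1 / real (m + 2)) \<longlonglongrightarrow> 0"
    using LIMSEQ_ignore_initial_segment[OF lim_inverse_n', of 2] by simp
  then have "compact T" unfolding T_def by (rule compact_sequence_with_limit)
  then have "compact A"
    unfolding A_def using assms
    by (intro compact_UN compact_continuous_image finite_lessThan
        continuous_on_compose2[OF continuous_on_circle_point[of UNIV]] continuous_intros) auto
  moreover have "countable A" unfolding A_def T_def by auto
  moreover have "A \<subseteq> S1" by (auto simp: A_def circle_point_in_S1)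
  ultimately have "is_continuity_set A" "measure circle_prob A = 0"
    by (auto intro!: is_continuity_set_countable_closed measure_countable compact_imp_closed)
  then have lim: "(\<lambda>N. (1 / real N) * (\<Sum>j=1..N. indicat_real A (circle_point (drifting_polygon_angle q j)))) \<longlonglongrightarrow> 0"
    using ud unfolding uniformly_distributed_def has_frequency_def by metis
  have "circle_point (drifting_polygon_angle q j) \<in> A" for j
    using assms by (auto simp: A_def T_def drifting_polygon_angle_def intro!: bexI[of _ "j mod q"])
  then have "(\<lambda>N. (1 / real N) * real N) \<longlonglongrightarrow> 0" using lim by simp
  moreover have "eventually (\<lambda>N. 1 = (1 / real N) * real N) sequentially"
    using eventually_gt_at_top[of 0] by eventually_elim simp
  then have "(\<lambda>N. (1 / real N) * real N) \<longlonglongrightarrow> 1"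
    by (rule Lim_transform_eventually[OF tendsto_const])
  ultimately show False using LIMSEQ_unique by fastforce
qed

section \<open>Arcs of rational and of irrational length\<close>

theorem theorem1:
  fixes a :: real and C :: "(real^2) set"
  assumes "0 < a" and "a < 1 / 2"
    and "is_arc C" and "measure circle_prob C = a"
  shows "(a \<in> \<rat> \<longrightarrow>
            (\<exists>u :: nat \<Rightarrow> real^2.
               (\<forall>j\<ge>1. u j \<in> S1) \<and>
               (\<forall>R :: real^2^2. rotation_matrix R \<longrightarrow> has_frequency u ((\<lambda>v. R *v v) ` C) a) \<and>
               \<not> uniformly_distributed u))
       \<and> (a \<notin> \<rat> \<longrightarrow>
            (\<forall>u :: nat \<Rightarrow> real^2.
               (\<forall>j\<ge>1. u j \<in> S1) \<and>
               (\<forall>R :: real^2^2. rotation_matrix R \<longrightarrow> has_frequency u ((\<lambda>v. R *v v) ` C) a)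
               \<longrightarrow> uniformly_distributed u))"
proof -
  obtain \<phi>0 where C: "C = cap \<phi>0 (cos (pi * a))"
    using arc_eq_cap[OF assms(3,4,1)] assms(2) by auto
  have all_caps: "(\<forall>R :: real^2^2. rotation_matrix R \<longrightarrow> has_frequency u ((\<lambda>v. R *v v) ` C) a)
      \<longleftrightarrow> (\<forall>\<phi>. has_frequency u (cap \<phi> (cos (pi * a))) a)" for u
    unfolding C by (rule all_rotations_cap)
  show ?thesis
  proof (intro conjI impI allI)
    assume "a \<in> \<rat>"
    then obtain p q :: nat where "q \<noteq> 0" "\<bar>a\<bar> = real p / real q"
      by (rule Rats_abs_nat_div_natE)
    with assms have a: "a = real p / real q" and q: "0 < q" by simp_all
    have "p < q" using assms(2) a q by (simp add: field_simps)
    then have "\<forall>\<phi>. has_frequency (\<lambda>j. circle_point (drifting_polygon_angle q j)) (cap \<phi> (cos (pi * a))) a"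
      unfolding a by (intro allI drifting_polygon_frequency)
    then show "\<exists>u. (\<forall>j\<ge>1. u j \<in> S1) \<and>
        (\<forall>R :: real^2^2. rotation_matrix R \<longrightarrow> has_frequency u ((\<lambda>v. R *v v) ` C) a) \<and>
        \<not> uniformly_distributed u"
      unfolding all_caps
      by (intro exI[of _ "\<lambda>j. circle_point (drifting_polygon_angle q j)"] conjI allI impI
          circle_point_in_S1 drifting_polygon_not_uniformly_distributed[OF q]) blast
  next
    fix u :: "nat \<Rightarrow> real^2"
    assume irr: "a \<notin> \<rat>"
    assume u: "(\<forall>j\<ge>1. u j \<in> S1) \<and>
        (\<forall>R :: real^2^2. rotation_matrix R \<longrightarrow> has_frequency u ((\<lambda>v. R *v v) ` C) a)"
    \<comment> \<open>\<open>u 0\<close> may lie off the circle, so angles exist only from index 1 on.\<close>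
    then have "\<forall>j. \<exists>t. j \<ge> 1 \<longrightarrow> u j = circle_point t"
      by (metis circle_point_surj)
    then obtain x where x: "\<And>j. j \<ge> 1 \<Longrightarrow> u j = circle_point (x j)" by metis
    have sums: "(\<Sum>j=1..N. f (circle_point (x j))) = (\<Sum>j=1..N. f (u j))" for f :: "real^2 \<Rightarrow> real" and N
      using x by (intro sum.cong) auto
    have freq: "has_frequency (\<lambda>j. circle_point (x j)) (cap \<phi> (cos (pi * a))) a" for \<phi>
    proof -
      have "has_frequency u (cap \<phi> (cos (pi * a))) a"
        using conjunct2[OF u] unfolding all_caps by (rule spec)
      then show ?thesis unfolding has_frequency_def sums .
    qed
    have weyl: "(\<lambda>N. (1 / real N) *\<^sub>R (\<Sum>j=1..N. cis (of_int n * x j))) \<longlonglongrightarrow> 0" if "n \<noteq> 0" for n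
      by (rule weyl_sums_tendsto_0[OF assms(1) _ irr that freq]) (use assms(2) in simp)
    show "uniformly_distributed u"
    proof (rule uniformly_distributed_if_continuous_averages)
      show "(\<lambda>N. (1 / real N) * (\<Sum>j=1..N. f (u j))) \<longlonglongrightarrow> integral\<^sup>L circle_prob f"
        if "continuous_on S1 f" for f
        using continuous_average[OF weyl that] unfolding sums .
    qed (use u in blast)
  qed
qed

end
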